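(* The D-optimal Data Fusion problem (DDF) is a special case of the maximum-entropy sampling problem (MESP): for every $\bm C\in\mathbb S^d_{++}$, all $\bm a_1,\dots,\bm a_n\in\mathbb R^d$ and every $s\in[n]$, there exist a matrix $\bm M\in\mathbb S^n_+$ of rank at least $s$ and a constant $\gamma\in\mathbb R$ such that for every $S\subseteq[n]$ with $|S|=s$, $$\log\det\Big(\bm C+\sum_{i\in S}\bm a_i\bm a_i^\top\Big)=\log\det\bm M_{S,S}+\gamma .$$
   Context: $[n]=\{1,\dots,n\}$; $\mathbb S^n_{+}$ and $\mathbb S^n_{++}$ are the sets of symmetric positive-semidefinite and positive-definite $n\times n$ matrices; $\bm M_{S,S}$ is the principal submatrix indexed by $S$. DDF is $\max_{S\subseteq[n],|S|=s}\log\det(\bm C+\sum_{i\in S}\bm a_i\bm a_i^\top)$. MESP, for a covariance matrix $\bm M\in\mathbb S^n_+$ of rank at least $s$, is $\max_{S\subseteq[n],|S|=s}\log\det\bm M_{S,S}$. "Special case" means that the objective functions agree on all feasible sets up to an additive constant. *)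

theory Defs
  imports
    Complex_Main
    "HOL-Library.Extended_Real"
    "Jordan_Normal_Form.Determinant"
    "Jordan_Normal_Form.DL_Rank"
    "Jordan_Normal_Form.DL_Submatrix"
begin

text \<open>
  Matrices and vectors are the carrier-based ones of Jordan_Normal_Form, so dimensions are
  natural numbers and indices are zero-based: the index set \<open>{1, \<dots>, n}\<close> becomes \<open>{..<n}\<close>.
\<close>

definition pos_semidef :: "nat \<Rightarrow> real mat \<Rightarrow> bool" where
  "pos_semidef n M \<longleftrightarrow>
     M \<in> carrier_mat n n \<and> transpose_mat M = M \<and>
     (\<forall>x \<in> carrier_vec n. x \<bullet> (M *\<^sub>v x) \<ge> 0)"

definition pos_def :: "nat \<Rightarrow> real mat \<Rightarrow> bool" where
  "pos_def n M \<longleftrightarrow>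
     M \<in> carrier_mat n n \<and> transpose_mat M = M \<and>
     (\<forall>x \<in> carrier_vec n. x \<noteq> 0\<^sub>v n \<longrightarrow> x \<bullet> (M *\<^sub>v x) > 0)"

text \<open>
  The objectives are extended-valued, with \<open>log 0 = -\<infinity>\<close>: a principal submatrix of a positive
  semidefinite matrix may be singular, and HOL's \<open>ln 0 = 0\<close> would give it a wrong finite value.
\<close>

definition log_det :: "real mat \<Rightarrow> ereal" where
  "log_det A = (if det A > 0 then ereal (ln (det A)) else -\<infinity>)"

text \<open>Entry \<open>(j, k)\<close> of \<open>a i\<close> times its transpose is \<open>a i $ j * a i $ k\<close>; the
  type of matrices has no zero of unspecified dimension, so the sum is taken entrywise.\<close>

definition sum_outer :: "nat \<Rightarrow> (nat \<Rightarrow> real vec) \<Rightarrow> nat set \<Rightarrow> real mat" where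
  "sum_outer d a S = mat d d (\<lambda>(j, k). \<Sum>i\<in>S. a i $ j * a i $ k)"

definition ddf_objective :: "nat \<Rightarrow> real mat \<Rightarrow> (nat \<Rightarrow> real vec) \<Rightarrow> nat set \<Rightarrow> ereal" where
  "ddf_objective d C a S = log_det (C + sum_outer d a S)"

definition mesp_objective :: "real mat \<Rightarrow> nat set \<Rightarrow> ereal" where
  "mesp_objective M S = log_det (submatrix M S S)"

end

theory Submission
  imports Defs
begin

text \<open>
  Take \<open>M = I + A\<^sup>T C\<^sup>-\<^sup>1 A\<close>, where \<open>A\<close> has the columns \<open>a i\<close>, and \<open>\<gamma> = ln (det C)\<close>. The principal
  submatrix of \<open>M\<close> at \<open>S\<close> is \<open>I + A\<^sub>S\<^sup>T C\<^sup>-\<^sup>1 A\<^sub>S\<close>, so the claim is the matrix determinant lemma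
  \<open>det (C + A\<^sub>S A\<^sub>S\<^sup>T) = det C * det (I + A\<^sub>S\<^sup>T C\<^sup>-\<^sup>1 A\<^sub>S)\<close>. As \<open>M\<close> is positive definite, its rank is \<open>n\<close>.
\<close>

section \<open>Positive definite matrices: determinant and inverse\<close>

lemma scalar_prod_self_pos:
  fixes x :: "real vec"
  assumes "x \<in> carrier_vec n" and "x \<noteq> 0\<^sub>v n"
  shows "0 < x \<bullet> x"
proof -
  obtain i where "i < n" "x $ i \<noteq> 0"
    using assms by (metis carrier_vecD eq_vecI index_zero_vec)
  then show ?thesis
    using assms unfolding scalar_prod_def by (intro sum_pos2[of _ i]) auto
qed

lemma pos_def_det_nonzero:
  assumes "pos_def n A"
  shows "det A \<noteq> 0"
proof
  assume "det A = 0"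
  with assms obtain v where "v \<in> carrier_vec n" "v \<noteq> 0\<^sub>v n" "A *\<^sub>v v = 0\<^sub>v n"
    unfolding pos_def_def using det_0_iff_vec_prod_zero[of A n] by blast
  with assms show False
    unfolding pos_def_def by fastforce
qed

lemma smult_mat_mult_vec:
  assumes "A \<in> carrier_mat nr nc" and "x \<in> carrier_vec nc"
  shows "(c \<cdot>\<^sub>m A) *\<^sub>v x = c \<cdot>\<^sub>v (A *\<^sub>v x)"
  using assms by (intro eq_vecI) (auto simp: scalar_prod_def sum_distrib_left mult.assoc)

lemma transpose_smult_mat: "transpose_mat (c \<cdot>\<^sub>m A) = c \<cdot>\<^sub>m transpose_mat A"
  by (rule eq_matI) auto

lemma pos_def_convex:
  assumes "pos_def n A" and "pos_def n B" and "0 \<le> t" "t \<le> 1"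
  shows "pos_def n ((1 - t) \<cdot>\<^sub>m A + t \<cdot>\<^sub>m B)"
proof -
  have A: "A \<in> carrier_mat n n" "transpose_mat A = A" and B: "B \<in> carrier_mat n n" "transpose_mat B = B"
    using assms unfolding pos_def_def by auto
  have "0 < x \<bullet> (((1 - t) \<cdot>\<^sub>m A + t \<cdot>\<^sub>m B) *\<^sub>v x)" if x: "x \<in> carrier_vec n" "x \<noteq> 0\<^sub>v n" for x
  proof -
    have "x \<bullet> (((1 - t) \<cdot>\<^sub>m A + t \<cdot>\<^sub>m B) *\<^sub>v x) = (1 - t) * (x \<bullet> (A *\<^sub>v x)) + t * (x \<bullet> (B *\<^sub>v x))"
      using A B x
      by (simp add: add_mult_distrib_mat_vec[of _ n n] scalar_prod_add_distrib[of _ n] smult_mat_mult_vec)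
    moreover have "0 < x \<bullet> (A *\<^sub>v x)" "0 < x \<bullet> (B *\<^sub>v x)"
      using assms x unfolding pos_def_def by auto
    ultimately show ?thesis
      \<comment> \<open>For \<open>t = 0\<close> the first summand is the strict one; for
        \<open>t > 0\<close> the second is, while the first may vanish at
        \<open>t = 1\<close>.\<close>
      using assms(3,4) by (cases "t = 0") (auto intro: add_nonneg_pos)
  qed
  then show ?thesis
    using A B by (simp add: pos_def_def transpose_add[of _ n n] transpose_smult_mat)
qed

text \<open>The Leibniz expansion makes the determinant a polynomial in the entries.\<close>

lemma continuous_on_det:
  fixes A :: "'a::topological_space \<Rightarrow> 'b::{comm_ring_1,real_normed_algebra_1} mat"
  assumes "\<And>t. t \<in> T \<Longrightarrow> A t \<in> carrier_mat n n"
    and "\<And>i j. i < n \<Longrightarrow> j < n \<Longrightarrow> continuous_on T (\<lambda>t. A t $$ (i, j))"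
  shows "continuous_on T (\<lambda>t. det (A t))"
proof -
  have "continuous_on T (\<lambda>t. \<Sum>p | p permutes {0..<n}. signof p * (\<Prod>i = 0..<n. A t $$ (i, p i)))"
    using assms(2) by (intro continuous_intros) (auto simp: permutes_in_image)
  then show ?thesis
    using assms(1) by (subst continuous_on_cong[OF refl det_def'[OF assms(1)]]) auto
qed

lemma pos_def_one: "pos_def n (1\<^sub>m n)"
  by (auto simp: pos_def_def intro: scalar_prod_self_pos)

text \<open>The segment from the identity to \<open>A\<close> stays positive definite, so \<open>det\<close> cannot vanish on it.\<close>
lemma pos_def_det_pos:
  assumes "pos_def n A"
  shows "0 < det A"
proof (rule ccontr)
  define P where "P t = (1 - t) \<cdot>\<^sub>m 1\<^sub>m n + t \<cdot>\<^sub>m A" for t :: real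
  assume "\<not> 0 < det A"
  have A: "A \<in> carrier_mat n n"
    using assms by (simp add: pos_def_def)
  have P: "P t \<in> carrier_mat n n" for t
    using A by (simp add: P_def)
  have "P 0 = 1\<^sub>m n" "P 1 = A"
    using A by (auto simp: P_def)
  moreover have "continuous_on {0..1} (\<lambda>t. det (P t))"
    using A by (intro continuous_on_det[of _ _ n] P) (auto simp: P_def intro!: continuous_intros)
  \<comment> \<open>The determinant is 1 at \<open>t = 0\<close> and, by the assumption to be
    refuted, at most 0 at \<open>t = 1\<close>.\<close>
  ultimately obtain t where "0 \<le> t" "t \<le> 1" "det (P t) = 0"
    using IVT2'[of "\<lambda>t. det (P t)" 1 0 0] \<open>\<not> 0 < det A\<close> by auto
  moreover have "pos_def n (P t)"
    unfolding P_def by (intro pos_def_convex pos_def_one assms) fact+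
  ultimately show False
    using pos_def_det_nonzero by blast
qed

text \<open>Semidefiniteness of the inverse is enough later, where the added identity matrix
  supplies strictness.\<close>

lemma pos_def_inverse:
  assumes "pos_def n A"
  obtains B where "pos_semidef n B" and "A * B = 1\<^sub>m n" and "B * A = 1\<^sub>m n"
proof -
  have A: "A \<in> carrier_mat n n" "transpose_mat A = A"
    using assms by (auto simp: pos_def_def)
  obtain B where B: "B \<in> carrier_mat n n" "A * B = 1\<^sub>m n" "B * A = 1\<^sub>m n"
    using det_non_zero_imp_unit[OF A(1) pos_def_det_nonzero[OF assms], of "()"]
    by (auto simp: Units_def ring_mat_def)
  \<comment> \<open>Symmetry of \<open>A\<close> allows the regrouping of
    \<open>B\<^sup>T (A B)\<close> as \<open>(A B)\<^sup>T B\<close>.\<close>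
  have "transpose_mat B = transpose_mat B * (A * B)"
    using B by simp
  also have "\<dots> = transpose_mat (A * B) * B"
    using A B(1) by (simp add: transpose_mult[of _ n n] assoc_mult_mat[of _ n n _ n _ n])
  also have "\<dots> = B"
    using B by simp
  finally have symm: "transpose_mat B = B" .
  have "0 \<le> x \<bullet> (B *\<^sub>v x)" if x: "x \<in> carrier_vec n" for x
  proof -
    \<comment> \<open>With \<open>x = A y\<close>, the form of \<open>B\<close> at \<open>x\<close>
      becomes the form of \<open>A\<close> at \<open>y\<close>.\<close>
    define y where "y = B *\<^sub>v x"
    have y: "y \<in> carrier_vec n"
      using B x by (simp add: y_def)
    have "A *\<^sub>v y = (A * B) *\<^sub>v x"
      unfolding y_def using A(1) B(1) x by (rule assoc_mult_mat_vec[symmetric])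
    then have "A *\<^sub>v y = x"
      using B(2) x by simp
    then have "x \<bullet> (B *\<^sub>v x) = y \<bullet> (A *\<^sub>v y)"
      using x y by (simp add: y_def[symmetric] comm_scalar_prod[of _ n])
    moreover have "0 \<le> y \<bullet> (A *\<^sub>v y)"
      using assms A y by (cases "y = 0\<^sub>v n") (auto simp: pos_def_def less_imp_le)
    ultimately show ?thesis by simp
  qed
  with B symm that show thesis
    by (auto simp: pos_semidef_def)
qed

section \<open>Congruences and the matrix determinant lemma\<close>

lemma congruence_quadratic_form:
  fixes D :: "'a::comm_ring_1 mat"
  assumes D: "D \<in> carrier_mat d d" and B: "B \<in> carrier_mat d m" and x: "x \<in> carrier_vec m"
  shows "x \<bullet> ((transpose_mat B * D * B) *\<^sub>v x) = (B *\<^sub>v x) \<bullet> (D *\<^sub>v (B *\<^sub>v x))"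
proof -
  have Bx: "B *\<^sub>v x \<in> carrier_vec d" and DBx: "D *\<^sub>v (B *\<^sub>v x) \<in> carrier_vec d"
    using B D x by simp_all
  have "(transpose_mat B * D * B) *\<^sub>v x = transpose_mat B *\<^sub>v (D *\<^sub>v (B *\<^sub>v x))"
    using B D x Bx
    by (simp add: assoc_mult_mat_vec[of _ m d _ m] assoc_mult_mat_vec[of _ m d _ d]
        assoc_mult_mat_vec[of _ d d _ m] assoc_mult_mat[of _ m d _ d _ m])
  moreover have "x \<bullet> (transpose_mat B *\<^sub>v (D *\<^sub>v (B *\<^sub>v x)))
      = (transpose_mat B *\<^sub>v (D *\<^sub>v (B *\<^sub>v x))) \<bullet> x"
    using B DBx x by (intro comm_scalar_prod[of _ m]) auto
  ultimately show ?thesis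
    using transpose_vec_mult_scalar[OF B x DBx] comm_scalar_prod[OF Bx DBx] by simp
qed

text \<open>The form at \<open>x\<close> is \<open>x \<bullet> x\<close>, positive for nonzero
  \<open>x\<close>, plus the form of \<open>D\<close> at \<open>B x\<close>, which is
  nonnegative.\<close>

lemma pos_def_one_plus_congruence:
  assumes "pos_semidef d D" and B: "B \<in> carrier_mat d m"
  shows "pos_def m (1\<^sub>m m + transpose_mat B * D * B)"
proof -
  have D: "D \<in> carrier_mat d d" "transpose_mat D = D"
    using assms by (auto simp: pos_semidef_def)
  define Q where "Q = transpose_mat B * D * B"
  have Q: "Q \<in> carrier_mat m m"
    using B D by (simp add: Q_def)
  have "0 < x \<bullet> ((1\<^sub>m m + Q) *\<^sub>v x)" if x: "x \<in> carrier_vec m" "x \<noteq> 0\<^sub>v m" for x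
  proof -
    have "0 \<le> x \<bullet> (Q *\<^sub>v x)"
      using assms(1) B x unfolding Q_def congruence_quadratic_form[OF D(1) B x(1)]
      by (simp add: pos_semidef_def)
    moreover have "x \<bullet> ((1\<^sub>m m + Q) *\<^sub>v x) = x \<bullet> x + x \<bullet> (Q *\<^sub>v x)"
      using Q x by (simp add: add_mult_distrib_mat_vec[of _ m m] scalar_prod_add_distrib[of _ m])
    ultimately show ?thesis
      using scalar_prod_self_pos[OF x] by simp
  qed
  moreover have "transpose_mat Q = Q"
  proof -
    have "transpose_mat Q = transpose_mat B * transpose_mat (transpose_mat B * D)"
      unfolding Q_def using B D by (intro transpose_mult[of _ m d]) auto
    also have "transpose_mat (transpose_mat B * D) = D * B"
      using B D by (subst transpose_mult[of _ m d _ d]) auto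
    finally show ?thesis
      using B D by (simp add: Q_def assoc_mult_mat[of _ m d _ d _ m])
  qed
  ultimately show ?thesis
    using Q unfolding Q_def[symmetric] by (simp add: pos_def_def transpose_add[of _ m m])
qed

text \<open>
  The block matrix with rows \<open>(C, -U)\<close> and \<open>(V, I)\<close> is made block triangular in two ways by
  unipotent column operations.
\<close>
lemma det_add_mult_inverse:
  fixes C :: "'a::idom mat"
  assumes C: "C \<in> carrier_mat d d" and D: "D \<in> carrier_mat d d" and CD: "C * D = 1\<^sub>m d"
    and U: "U \<in> carrier_mat d m" and V: "V \<in> carrier_mat m d"
  shows "det (C + U * V) = det C * det (1\<^sub>m m + V * D * U)"
proof -
  let ?N = "four_block_mat C (- U) V (1\<^sub>m m)"
  \<comment> \<open>The block \<open>D * U\<close> of \<open>?E\<close> clears \<open>- U\<close>,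
    since \<open>C * (D * U) = U\<close>; the block \<open>- V\<close> of \<open>?F\<close> clears
    \<open>V\<close> against the identity.\<close>
  let ?E = "four_block_mat (1\<^sub>m d) (D * U) (0\<^sub>m m d) (1\<^sub>m m)"
  let ?F = "four_block_mat (1\<^sub>m d) (0\<^sub>m d m) (- V) (1\<^sub>m m)"
  have N: "?N \<in> carrier_mat (d + m) (d + m)" and E: "?E \<in> carrier_mat (d + m) (d + m)"
    and F: "?F \<in> carrier_mat (d + m) (d + m)"
    using C by auto
  have "C * (D * U) = C * D * U"
    using C D U by (rule assoc_mult_mat[symmetric])
  then have CDU: "C * (D * U) = U"
    using CD U by simp
  have "- U * 1\<^sub>m m = - U"
    using U by simp
  moreover have "U + - U = 0\<^sub>m d m"
    using U by auto
  moreover have "V * (D * U) + 1\<^sub>m m = 1\<^sub>m m + V * D * U"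
    using U V D by (simp add: assoc_mult_mat[of _ m d _ d _ m] comm_add_mat[of "V * (D * U)" m m])
  ultimately have NE: "?N * ?E = four_block_mat C (0\<^sub>m d m) V (1\<^sub>m m + V * D * U)"
    using C D U V CDU by (subst mult_four_block_mat[of _ d d _ m _ m _ _ d _ m]) auto
  have NF: "?N * ?F = four_block_mat (C + U * V) (- U) (0\<^sub>m m d) (1\<^sub>m m)"
    using assms by (subst mult_four_block_mat[of _ d d _ m _ m _ _ d _ m]) auto
  have "det ?N = det ?N * det ?E"
    using U D by (simp add: det_four_block_mat_lower_left_zero[of _ d _ m])
  also have "\<dots> = det C * det (1\<^sub>m m + V * D * U)"
    using assms by (simp add: NE det_four_block_mat_upper_right_zero[of _ d _ m] flip: det_mult[OF N E])
  finally have "det C * det (1\<^sub>m m + V * D * U) = det ?N" ..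
  also have "det ?N = det ?N * det ?F"
    using V by (simp add: det_four_block_mat_upper_right_zero[of _ d _ m])
  also have "det ?N * det ?F = det (C + U * V)"
    using assms by (simp add: NF det_four_block_mat_lower_left_zero[of _ d _ m] flip: det_mult[OF N F])
  finally show ?thesis ..
qed

section \<open>Selecting columns and principal submatrices\<close>

definition col_mat :: "nat \<Rightarrow> nat \<Rightarrow> (nat \<Rightarrow> 'a vec) \<Rightarrow> 'a mat" where
  "col_mat d m b = mat d m (\<lambda>(j, i). b i $ j)"

lemma col_mat_carrier [simp]: "col_mat d m b \<in> carrier_mat d m"
  by (simp add: col_mat_def)

lemma dim_col_mat [simp]:
  "dim_row (col_mat d m b) = d" "dim_col (col_mat d m b) = m"
  by (simp_all add: col_mat_def)

text \<open>\<open>pick S\<close> lists \<open>S\<close> increasingly from index 0, hence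
  injectively; its image then has as many elements as \<open>S\<close>.\<close>

lemma bij_betw_pick:
  assumes "finite S"
  shows "bij_betw (pick S) {..<card S} S"
proof -
  have inj: "inj_on (pick S) {..<card S}"
    by (rule linorder_inj_onI) (auto simp: pick_mono_le less_imp_neq)
  moreover have "pick S ` {..<card S} = S"
    by (rule card_subset_eq[OF assms]) (auto simp: pick_in_set_le card_image[OF inj])
  ultimately show ?thesis by (simp add: bij_betw_def)
qed

lemma sum_outer_eq_col_mat:
  assumes "finite S"
  shows "sum_outer d a S
    = col_mat d (card S) (a \<circ> pick S) * transpose_mat (col_mat d (card S) (a \<circ> pick S))"
  by (rule eq_matI)
    (simp_all add: sum_outer_def col_mat_def scalar_prod_def atLeast0LessThan
      sum.reindex_bij_betw[OF bij_betw_pick[OF assms], of "\<lambda>i. a i $ _ * a i $ _", symmetric])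

text \<open>Entry \<open>(i, j)\<close> of the product involves only columns \<open>i\<close> and
  \<open>j\<close> of \<open>col_mat\<close>, so restricting rows and columns to \<open>S\<close>
  amounts to selecting the columns in \<open>S\<close>.\<close>

lemma submatrix_gram:
  fixes D :: "'a::comm_ring_1 mat"
  assumes "S \<subseteq> {..<n}" and D: "D \<in> carrier_mat d d"
  shows "submatrix (1\<^sub>m n + transpose_mat (col_mat d n a) * D * col_mat d n a) S S
    = 1\<^sub>m (card S) + transpose_mat (col_mat d (card S) (a \<circ> pick S)) * D * col_mat d (card S) (a \<circ> pick S)"
proof -
  have S: "{i. i < n \<and> i \<in> S} = S" and fin: "finite S"
    using assms by (auto intro: finite_subset)
  have pick: "pick S i < n" if "i < card S" for i
    using pick_in_set_le[OF that] assms by auto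
  have col: "col (col_mat d n a) (pick S i) = col (col_mat d (card S) (a \<circ> pick S)) i" if "i < card S" for i
    using pick[OF that] that by (auto simp: col_mat_def)
  \<comment> \<open>In this bracketing an entry is a column of \<open>col_mat\<close> times a column
    of \<open>D * col_mat\<close>.\<close>
  have assoc: "transpose_mat (col_mat d m b) * D * col_mat d m b
      = transpose_mat (col_mat d m b) * (D * col_mat d m b)" for m and b :: "nat \<Rightarrow> 'a vec"
    using D by (intro assoc_mult_mat[of _ m d _ d _ m]) simp_all
  have colD: "col (D * col_mat d n a) (pick S i) = col (D * col_mat d (card S) (a \<circ> pick S)) i"
    if "i < card S" for i
    using col_mult2[OF D col_mat_carrier pick[OF that]] col_mult2[OF D col_mat_carrier that]
      col[OF that] by simp
  \<comment> \<open>Needed for the identity summand: its diagonal must restrict to the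
    diagonal.\<close>
  have inj: "pick S i = pick S j \<longleftrightarrow> i = j" if "i < card S" "j < card S" for i j
    using bij_betw_pick[OF fin] that by (auto simp: bij_betw_def inj_on_def)
  show ?thesis
    unfolding assoc using D
    by (intro eq_matI) (auto simp: submatrix_def S pick inj col colD)
qed

theorem theorem2:
  fixes d n s :: nat
    and C :: "real mat"
    and a :: "nat \<Rightarrow> real vec"
  assumes "pos_def d C"
    and "\<And>i. i < n \<Longrightarrow> a i \<in> carrier_vec d"
    and "1 \<le> s" and "s \<le> n"
  shows "\<exists>M \<gamma>. pos_semidef n M \<and> s \<le> vec_space.rank n M \<and>
           (\<forall>S. S \<subseteq> {..<n} \<and> card S = s \<longrightarrow>
              ddf_objective d C a S = mesp_objective M S + ereal \<gamma>)"
proof -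
  obtain D where D: "pos_semidef d D" "C * D = 1\<^sub>m d"
    using pos_def_inverse[OF assms(1)] by blast
  have carr: "C \<in> carrier_mat d d" "D \<in> carrier_mat d d"
    using assms(1) D by (auto simp: pos_def_def pos_semidef_def)
  \<comment> \<open>One family covers both matrices: \<open>G n a\<close> is the witness
    \<open>M\<close>, and its principal submatrix at \<open>S\<close> is
    \<open>G (card S) (a \<circ> pick S)\<close>.\<close>
  define G where "G m b = 1\<^sub>m m + transpose_mat (col_mat d m b) * D * col_mat d m b" for m b
  have G: "pos_def m (G m b)" for m b
    unfolding G_def by (rule pos_def_one_plus_congruence[OF D(1)]) simp
  have semidef: "pos_semidef n (G n a)"
    using G[of n a] unfolding pos_def_def pos_semidef_def
    by (metis less_imp_le order_refl scalar_prod_left_zero mult_mat_vec_carrier)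
  have "vec_space.rank n (G n a) = n"
    using G[of n a] pos_def_det_nonzero vec_space.low_rank_det_zero by (metis pos_def_def)
  moreover have "ddf_objective d C a S = mesp_objective (G n a) S + ereal (ln (det C))"
    if S: "S \<subseteq> {..<n}" for S
  proof -
    have sub: "submatrix (G n a) S S = G (card S) (a \<circ> pick S)"
      unfolding G_def using S carr(2) by (rule submatrix_gram)
    have "det (C + sum_outer d a S) = det C * det (submatrix (G n a) S S)"
      unfolding sub unfolding G_def sum_outer_eq_col_mat[OF finite_subset[OF S finite_lessThan]]
      by (rule det_add_mult_inverse[OF carr D(2)]) simp_all
    then show ?thesis
      \<comment> \<open>Both factors are positive, so each \<open>log_det\<close> takes its finite
        branch and \<open>ln\<close> splits the product.\<close>
      using pos_def_det_pos[OF assms(1)] pos_def_det_pos[OF G[of "card S" "a \<circ> pick S"]]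
      by (simp add: sub ddf_objective_def mesp_objective_def log_det_def ln_mult)
  qed
  ultimately show ?thesis
    using semidef assms(4) by (intro exI[of _ "G n a"] exI[of _ "ln (det C)"]) auto
qed

end
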